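(* Let $E = E^n \subset \mathbb{R}^n$, $n \ge 2$, be a closed Euclidean unit ball and $f : E \to \mathbb{R}$ a continuous function. Then $f$ has a contour $C$ such that (i) if $n = 2$: $\operatorname{diam}(C \cap \partial E) \ge \sqrt{3}$; (ii) if $n \ge 3$: $\operatorname{diam}(C \cap \partial E) = 2$.
   Context: A contour of $f : E \to \mathbb{R}$ is a connected component of a level set $f^{-1}(y)$ for some $y \in \mathbb{R}$. $\partial E$ is the unit sphere bounding $E$; diameters are with respect to the Euclidean distance. *)

theory Defs
  imports "HOL-Analysis.Analysis"
begin

(* components yields only nonempty sets, so an empty level set has no contour. *)
definition contour_of :: "('a::topological_space \<Rightarrow> 'b) \<Rightarrow> 'a set \<Rightarrow> 'a set \<Rightarrow> bool" where
  "contour_of f E C \<longleftrightarrow> (\<exists>y. C \<in> components {x \<in> E. f x = y})"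

end

theory Submission
  imports Defs
begin

text \<open>
  For a full-support finite measure on a unicoherent Peano continuum there is a median contour:
  one whose complement has no component carrying more than half of the total mass.

  For \<open>n \<ge> 3\<close> the sphere is unicoherent. Let \<open>C\<close> be a median contour of \<open>f\<close> on the sphere for an
  antipodally symmetric measure. If \<open>C\<close> misses \<open>- C\<close>, let \<open>U\<close> be the component of the complement of
  \<open>C\<close> that contains \<open>- C\<close>. The antipodal image of the complement of \<open>U\<close> has at least half of the
  mass and is properly contained in a component of the complement of \<open>C\<close>, a contradiction.

  For \<open>n = 2\<close> the disc is unicoherent; give it a measure concentrated mainly and uniformly on the
  boundary circle. If a median contour met the circle in a set of diameter less than \<open>sqrt 3\<close>, this
  set would lie in an arc of less than 120 degrees, and the complementary arc would lie in a
  single component of more than half of the mass.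
\<close>

subsection \<open>Median contours\<close>

text \<open>Interpreted twice below: by the unit sphere in dimension at least 3 and by the closed
  unit disc, so that one median argument serves both cases.\<close>

locale unicoherent_continuum =
  fixes X :: "'a::euclidean_space set" and f :: "'a \<Rightarrow> real"
  assumes cpt: "compact X" and conn: "connected X" and lpc: "locally path_connected X"
    and uni: "unicoherent X" and cont: "continuous_on X f"
begin

text \<open>\<open>band x 0\<close> is the contour through \<open>x\<close>. For
  \<open>e > 0\<close> the band is a closed connected neighbourhood in \<open>X\<close> of a point
  \<open>x\<close> of \<open>X\<close>; it replaces the contour where room for perturbation is
  needed.\<close>

definition band :: "'a \<Rightarrow> real \<Rightarrow> 'a set" where
  "band x e = connected_component_set {z \<in> X. \<bar>f z - f x\<bar> \<le> e} x"

lemma locally_connected_X: "locally connected X"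
  using locally_path_connected_imp_locally_connected lpc by blast

lemma closed_X: "closed X"
  by (simp add: compact_imp_closed cpt)

lemma band_self: "x \<in> X \<Longrightarrow> 0 \<le> e \<Longrightarrow> x \<in> band x e"
  by (simp add: band_def)

lemma band_subset: "band x e \<subseteq> X"
  unfolding band_def using connected_component_subset by fastforce

lemma band_le: "z \<in> band x e \<Longrightarrow> \<bar>f z - f x\<bar> \<le> e"
  unfolding band_def using connected_component_subset by fastforce

lemma connected_band [simp]: "connected (band x e)"
  by (simp add: band_def)

lemma band_mono: "d \<le> e \<Longrightarrow> band x d \<subseteq> band x e"
  unfolding band_def by (rule connected_component_mono) auto

lemma band_maximal:
  assumes "connected K" "K \<inter> band x e \<noteq> {}" "\<And>z. z \<in> K \<Longrightarrow> z \<in> X \<and> \<bar>f z - f x\<bar> \<le> e"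
  shows "K \<subseteq> band x e"
proof -
  obtain k where k: "k \<in> K" "k \<in> band x e" using assms(2) by auto
  have "band x e = connected_component_set {z \<in> X. \<bar>f z - f x\<bar> \<le> e} k"
    using k(2) unfolding band_def by (metis connected_component_eq)
  then show ?thesis
    using connected_component_maximal[OF k(1) assms(1)] assms(3) by (metis (no_types, lifting) mem_Collect_eq subsetI)
qed

lemma closed_band: "closed (band x e)"
proof -
  have "closed {z \<in> X. \<bar>f z - f x\<bar> \<le> e}"
  proof -
    have "closedin (top_of_set X) (X \<inter> (\<lambda>z. \<bar>f z - f x\<bar>) -` {..e})"
      by (intro continuous_closedin_preimage continuous_intros cont closed_atMost)
    then have "closed (X \<inter> (\<lambda>z. \<bar>f z - f x\<bar>) -` {..e})"
      using closed_X closedin_closed_trans by blast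
    then show ?thesis by (simp add: vimage_def Int_def)
  qed
  then show ?thesis
    by (simp add: band_def closed_connected_component)
qed

lemma compact_band: "compact (band x e)"
  using band_subset closed_band cpt by (metis compact_Int_closed inf.absorb_iff2 inf.commute)

lemma band_0_subset:
  assumes "y \<in> band x e"
  shows "band y 0 \<subseteq> band x e"
proof (rule band_maximal)
  show "band y 0 \<inter> band x e \<noteq> {}"
    using assms band_self[of y 0] band_subset by fastforce
  show "z \<in> X \<and> \<bar>f z - f x\<bar> \<le> e" if "z \<in> band y 0" for z
    using that band_le[OF assms] band_le[OF that] band_subset by auto
qed auto

text \<open>A decreasing intersection of compact connected sets is connected, and \<open>f\<close>
  is constant on this one, so maximality of \<open>band x 0\<close> applies.\<close>

lemma band_0_eq_INT:
  assumes "x \<in> X"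
  shows "(\<Inter>n::nat. band x (inverse (Suc n))) = band x 0"
proof
  show "band x 0 \<subseteq> (\<Inter>n::nat. band x (inverse (Suc n)))"
    by (intro INF_greatest band_mono) simp
  have "connected (\<Inter>(range (\<lambda>n::nat. band x (inverse (Suc n)))))"
    by (intro connected_nest compact_band connected_band band_mono) (simp add: field_simps)
  then show "(\<Inter>n::nat. band x (inverse (Suc n))) \<subseteq> band x 0"
  proof (rule band_maximal)
    show "(\<Inter>n::nat. band x (inverse (Suc n))) \<inter> band x 0 \<noteq> {}"
    proof -
      have "x \<in> (\<Inter>n::nat. band x (inverse (Suc n))) \<inter> band x 0"
        by (intro IntI INT_I band_self assms) auto
      then show ?thesis by blast
    qed
    show "z \<in> X \<and> \<bar>f z - f x\<bar> \<le> 0" if "z \<in> (\<Inter>n::nat. band x (inverse (Suc n)))" for z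
    proof -
      have "\<bar>f z - f x\<bar> \<le> inverse (Suc n)" for n
        using that band_le by blast
      then have "\<bar>f z - f x\<bar> \<le> 0"
        using LIMSEQ_inverse_real_of_nat LIMSEQ_le_const by blast
      then show ?thesis using that band_subset by blast
    qed
  qed
qed

lemma contour_of_band:
  assumes "x \<in> X"
  shows "contour_of f X (band x 0)"
proof -
  have "{z \<in> X. \<bar>f z - f x\<bar> \<le> 0} = {z \<in> X. f z = f x}" by auto
  then show ?thesis
    using assms by (auto simp: contour_of_def band_def intro!: exI[of _ "f x"] componentsI)
qed

text \<open>By local connectedness, \<open>z\<close> has a connected neighbourhood on which
  \<open>f\<close> still stays within \<open>e\<close> of \<open>f x\<close>; maximality makes the
  band absorb it.\<close>

lemma band_neighbourhood:
  assumes "z \<in> band x e" "\<bar>f z - f x\<bar> < e"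
  obtains V where "openin (top_of_set X) V" "z \<in> V" "V \<subseteq> band x e"
proof -
  have z: "z \<in> X" using assms band_subset by blast
  have "openin (top_of_set X) (X \<inter> (\<lambda>w. \<bar>f w - f x\<bar>) -` {..<e})"
    by (intro continuous_openin_preimage_gen continuous_intros cont open_lessThan)
  then obtain V where V: "openin (top_of_set X) V" "connected V" "z \<in> V"
      "V \<subseteq> X \<inter> (\<lambda>w. \<bar>f w - f x\<bar>) -` {..<e}"
    using locally_connected_X z assms(2) unfolding locally_connected
    by (metis (no_types, lifting) IntI lessThan_iff vimageI)
  have "V \<subseteq> band x e"
  proof (rule band_maximal)
    show "V \<inter> band x e \<noteq> {}" using V(3) assms(1) by blast
    show "w \<in> X \<and> \<bar>f w - f x\<bar> \<le> e" if "w \<in> V" for w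
      using V(4) that by fastforce
  qed (rule V)
  with V that show ?thesis by blast
qed

section \<open>Complementary components of bands and their frontiers\<close>

lemma openin_component:
  assumes "H \<in> components (X - K)" "closed K"
  shows "openin (top_of_set X) H"
proof -
  have "openin (top_of_set X) (X - K)"
    using assms(2) by (metis Diff_eq open_Compl openin_open)
  then show ?thesis
    using locally_connected_X assms(1) locally_connected_open_component by blast
qed

lemma borel_component:
  assumes "H \<in> components (X - K)" "closed K"
  shows "H \<in> sets borel"
proof -
  obtain T where "open T" "H = X \<inter> T"
    using openin_component[OF assms] openin_open by blast
  then show ?thesis using closed_X by auto
qed

lemma clopen_X:
  assumes "openin (top_of_set X) A" "closed A" "A \<noteq> {}"
  shows "A = X"
proof -
  have "A \<subseteq> X" using assms(1) openin_imp_subset by blast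
  then show ?thesis
    using assms conn unfolding connected_clopen by (meson closed_subset)
qed

text \<open>A frontier point outside the band could be added to \<open>H\<close> without losing
  connectedness. One where \<open>f\<close> is strictly within \<open>e\<close> of
  \<open>f x\<close> has a neighbourhood inside the band, hence away from \<open>H\<close>.\<close>

lemma component_frontier:
  assumes H: "H \<in> components (X - band x e)" and z: "z \<in> closure H - H"
  shows "z \<in> X \<and> z \<in> band x e \<and> \<bar>f z - f x\<bar> = e"
proof -
  have HX: "H \<subseteq> X - band x e" "connected H"
    using H in_components_subset in_components_connected by auto
  have zX: "z \<in> X"
    using z HX(1) closed_X closure_minimal by blast
  have zb: "z \<in> band x e"
  proof (rule ccontr)
    assume n: "z \<notin> band x e"
    have "connected (insert z H)"
      by (rule connected_intermediate_closure[OF HX(2)]) (use z closure_subset in auto)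
    then have "insert z H \<subseteq> H"
      using components_maximal[OF H] n zX HX in_components_nonempty[OF H] by blast
    then show False using z by blast
  qed
  moreover have "\<not> \<bar>f z - f x\<bar> < e"
  proof
    assume "\<bar>f z - f x\<bar> < e"
    with zb obtain V where V: "openin (top_of_set X) V" "z \<in> V" "V \<subseteq> band x e"
      using band_neighbourhood by blast
    obtain T where T: "open T" "V = X \<inter> T" using V(1) openin_open by blast
    have "T \<inter> H \<noteq> {}"
      using T V z open_Int_closure_eq_empty by fastforce
    then show False using T HX V by blast
  qed
  ultimately show ?thesis using zX band_le[OF zb] by simp
qed

text \<open>Unicoherence makes the frontier of \<open>H\<close> connected; since \<open>f\<close> only takes the values
  \<open>f x \<plusminus> e\<close> there, the frontier lies in one contour.\<close>

lemma component_of_contour_complement: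
  assumes H: "H \<in> components (X - band x e)" and x: "x \<in> X" and e: "0 < e"
  obtains y where "y \<in> X" "y \<in> band x e" "\<bar>f y - f x\<bar> = e" "H \<in> components (X - band y 0)"
proof -
  have HX: "H \<subseteq> X - band x e" "connected H" "H \<noteq> {}"
    using in_components_subset[OF H] in_components_connected[OF H] in_components_nonempty[OF H] by auto
  have opH: "openin (top_of_set X) H" using openin_component[OF H closed_band] .
  have clX: "closure H \<subseteq> X" using HX closed_X closure_minimal by blast
  have "connected (X - H)"
    by (rule component_diff_connected[OF connected_band conn band_subset H])
  then have "connected (closure H \<inter> (X - H))"
    using HX clX opH closure_subset
    by (intro unicoherentD[OF uni])
       (auto intro: connected_imp_connected_closure closed_subset closedin_diff)
  then have conF: "connected (closure H - H)"
    using clX by (metis Diff_Int_distrib inf.absorb_iff2 inf.commute Int_Diff)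
  have "closure H - H \<noteq> {}"
  proof
    assume "closure H - H = {}"
    then have "closed H" by (metis Diff_eq_empty_iff closure_subset closure_closed subset_antisym closed_closure)
    then have "H = X" using clopen_X opH HX by blast
    then show False using HX band_self[OF x, of e] e x by auto
  qed
  then obtain y where y: "y \<in> closure H - H" by blast
  note fr = component_frontier[OF H]
  have const: "f z = f y" if z: "z \<in> closure H - H" for z
  proof (rule ccontr)
    assume ne: "f z \<noteq> f y"
    have "connected (f ` (closure H - H))"
      using conF clX cont by (meson Diff_subset connected_continuous_image continuous_on_subset order_trans)
    then have c: "is_interval (f ` (closure H - H))"
      by (simp add: is_interval_connected_1)
    \<comment> \<open>Two different values on the frontier must be \<open>f x - e\<close> and
      \<open>f x + e\<close>, so the intermediate value \<open>f x\<close> would be attained there.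
      The \<open>if\<close> terms select the points with the smaller and the larger value.\<close>
    have "f x \<in> f ` (closure H - H)"
    proof (rule mem_is_interval_1_I[OF c imageI imageI])
      show "(if f z < f x then z else y) \<in> closure H - H" "(if f z < f x then y else z) \<in> closure H - H"
        using y z by auto
    qed (use fr[OF y] fr[OF z] ne e in \<open>auto split: if_splits\<close>)
    then show False using fr e by fastforce
  qed
  have sub: "closure H - H \<subseteq> band y 0"
  proof (rule band_maximal[OF conF])
    show "(closure H - H) \<inter> band y 0 \<noteq> {}"
      using y fr[OF y] band_self[of y 0] by blast
    show "z \<in> X \<and> \<bar>f z - f y\<bar> \<le> 0" if "z \<in> closure H - H" for z
      using const[OF that] clX that by simp blast
  qed
  have yb: "y \<in> band x e" and yX: "y \<in> X" and fy: "\<bar>f y - f x\<bar> = e" using fr[OF y] by auto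
  have b: "band y 0 \<subseteq> band x e" by (rule band_0_subset[OF yb])
  have "H \<in> components (X - band y 0)"
    unfolding in_components_maximal
  proof (intro conjI allI impI; (elim conjE)?)
    \<comment> \<open>\<open>K\<close> avoids the frontier of \<open>H\<close>, which lies in
      \<open>band y 0\<close>; so \<open>H\<close> is both closed and open in the connected set
      \<open>K\<close>.\<close>
    fix K assume K: "K \<noteq> {}" "H \<subseteq> K" "K \<subseteq> X - band y 0" "connected K"
    have "H = K \<inter> closure H" using K sub closure_subset[of H] by blast
    then have "closedin (top_of_set K) H" by (metis closed_closure closedin_closed_Int)
    moreover have "openin (top_of_set K) H"
      using opH K by (meson Diff_subset openin_subset_trans order_trans)
    ultimately show "K = H" using K HX unfolding connected_clopen by blast
  qed (use HX b in auto)
  with yX yb fy that show ?thesis by blast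
qed

text \<open>As the removed band shrinks, the component containing a fixed point of \<open>H\<close>
  increases to \<open>H\<close>; by continuity of the measure from below, its mass exceeds
  \<open>t\<close> at some positive width.\<close>

lemma component_approximation:
  fixes M :: "'a measure"
  assumes M: "finite_measure M" "sets M = sets borel" and x: "x \<in> X"
    and H: "H \<in> components (X - band x 0)" and t: "t < measure M H" "0 \<le> t" and d: "0 < d"
  obtains e H' where "0 < e" "e < d" "H' \<in> components (X - band x e)" "t < measure M H'"
proof -
  interpret M: finite_measure M by fact
  obtain p where p: "p \<in> H" using H in_components_nonempty by blast
  have HX: "H \<subseteq> X - band x 0" "connected H"
    using H in_components_subset in_components_connected by auto
  define b where "b n = band x (inverse (Suc n))" for n :: nat
  have b_anti: "b n \<subseteq> b m" if "m \<le> n" for m n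
    unfolding b_def using that by (intro band_mono) (simp add: field_simps)
  have b0: "(\<Inter>n. b n) = band x 0"
    unfolding b_def by (rule band_0_eq_INT[OF x])
  define K where "K n = connected_component_set (X - b n) p" for n
  have K: "K n = {} \<or> K n \<in> components (X - b n)" for n
    unfolding K_def components_def by (metis connected_component_eq_empty image_eqI)
  have "K n \<in> sets borel" for n
    using K[of n] borel_component[of "K n" "b n"] closed_band by (auto simp: b_def)
  moreover have "incseq K"
    unfolding K_def by (intro incseq_SucI connected_component_mono Diff_mono b_anti) auto
  moreover have "(\<Union>n. K n) = H"
  proof (intro equalityI UN_least subsetI)
    fix n z assume z: "z \<in> K n"
    have "K n \<subseteq> H"
    proof (rule components_maximal[OF H])
      have "K n \<subseteq> X - b n" unfolding K_def by (rule connected_component_subset)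
      then show "K n \<subseteq> X - band x 0" using b0 by blast
      have "p \<in> K n" using z unfolding K_def
        by (metis connected_component_in connected_component_refl mem_Collect_eq)
      then show "H \<inter> K n \<noteq> {}" using p by blast
    qed (simp add: K_def)
    then show "z \<in> H" using z by blast
  next
    \<comment> \<open>A path from \<open>p\<close> to \<open>q\<close> inside \<open>H\<close> is
      compact and misses the intersection of the bands, so it already misses one of them.\<close>
    fix q assume q: "q \<in> H"
    have "locally path_connected H"
      using locally_open_subset[OF lpc openin_component[OF H closed_band]] .
    then have "path_component H p q"
      using p q HX(2) by (simp add: path_component_eq_connected_component connected_iff_connected_component)
    then obtain g where g: "path g" "path_image g \<subseteq> H" "pathstart g = p" "pathfinish g = q"
      unfolding path_component_def by blast
    have "\<exists>n. path_image g \<inter> b n = {}"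
    proof (rule ccontr)
      assume "\<not> ?thesis"
      then have "\<Inter>(range (\<lambda>n. path_image g \<inter> b n)) \<noteq> {}"
        using b_anti g(1) by (intro compact_nest) (auto simp: b_def intro!: compact_Int_closed closed_band compact_path_image)
      then show False using b0 g(2) HX(1) by auto
    qed
    then obtain n where "path_image g \<inter> b n = {}" by blast
    then have "connected_component (X - b n) p q"
      using g HX(1) by (intro connected_componentI[of "path_image g"] connected_path_image) auto
    then show "q \<in> (\<Union>n. K n)" by (auto simp: K_def)
  qed
  ultimately have "(\<lambda>n. measure M (K n)) \<longlonglongrightarrow> measure M H"
    using M.finite_Lim_measure_incseq[of K] M(2) by auto
  then have "\<forall>\<^sub>F n in sequentially. t < measure M (K n)"
    using t order_tendstoD(1) by blast
  moreover have "\<forall>\<^sub>F n in sequentially. inverse (Suc n) < d"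
    using LIMSEQ_inverse_real_of_nat d order_tendstoD(2) by blast
  ultimately obtain n where n: "t < measure M (K n)" "inverse (Suc n) < d"
    using eventually_happens'[OF sequentially_bot eventually_conj] by blast
  \<comment> \<open>\<open>K n\<close> is empty when \<open>p\<close> lies in the removed band; its
    measure, being above \<open>t\<close>, excludes this.\<close>
  then have "K n \<noteq> {}" using t by auto
  then show ?thesis using K[of n] n by (intro that[of "inverse (Suc n)" "K n"]) (auto simp: b_def)
qed

text \<open>Otherwise let \<open>H x\<close> be the heavy component of the complement of the contour through \<open>x\<close>, and
  let \<open>x\<close> be a limit of points along which the measure of \<open>H\<close> tends to its infimum \<open>m\<close>. All heavy
  components of complements of bands at \<open>x\<close> then have measure exactly \<open>m\<close>, but they grow strictly
  as the band shrinks, against full support.\<close>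

theorem median_contour:
  fixes M :: "'a measure"
  assumes M: "finite_measure M" "sets M = sets borel" and ne: "X \<noteq> {}"
    and pos: "\<And>U. openin (top_of_set X) U \<Longrightarrow> U \<noteq> {} \<Longrightarrow> 0 < measure M U"
  obtains x where "x \<in> X" "\<And>U. U \<in> components (X - band x 0) \<Longrightarrow> measure M U \<le> measure M X / 2"
proof (rule ccontr)
  assume "\<not> thesis"
  then have "\<forall>x\<in>X. \<exists>U. U \<in> components (X - band x 0) \<and> measure M X / 2 < measure M U"
    using that not_le by blast
  then obtain H where H: "\<And>x. x \<in> X \<Longrightarrow> H x \<in> components (X - band x 0)"
    and heavyH: "\<And>x. x \<in> X \<Longrightarrow> measure M X / 2 < measure M (H x)"
    by metis
  interpret M: finite_measure M by fact
  have sX: "X \<in> sets M" using closed_X M(2) by auto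
  have comp_sets: "U \<in> sets M" if "U \<in> components (X - band x e)" for U x e
    using borel_component[OF that closed_band] M(2) by simp
  have overlap: "A \<inter> B \<noteq> {}"
    if "A \<in> sets M" "B \<in> sets M" "A \<subseteq> X" "B \<subseteq> X"
      "measure M X / 2 < measure M A" "measure M X / 2 < measure M B" for A B
  proof
    assume "A \<inter> B = {}"
    then have "measure M A + measure M B = measure M (A \<union> B)"
      using that by (simp add: M.finite_measure_Union)
    also have "\<dots> \<le> measure M X"
      using that sX by (intro M.finite_measure_mono) auto
    finally show False using that by simp
  qed
  \<comment> \<open>Two sets with more than half of the mass meet, so passing to a smaller band can
    only enlarge the heavy component.\<close>
  have heavy_sub: "A \<subseteq> B"
    if A: "A \<in> components (X - band x d)" and B: "B \<in> components (X - band y e)"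
      and "measure M X / 2 < measure M A" "measure M X / 2 < measure M B"
      and sub: "band y e \<subseteq> band x d" for A B x y d e
  proof (rule components_maximal[OF B])
    show "connected A" using A in_components_connected by blast
    have "A \<subseteq> X - band x d" using A by (rule in_components_subset)
    then show "A \<subseteq> X - band y e" using sub by blast
    have "B \<subseteq> X" using in_components_subset[OF B] by blast
    then show "B \<inter> A \<noteq> {}"
      using \<open>A \<subseteq> X - band x d\<close> that comp_sets[OF A] comp_sets[OF B] by (intro overlap) auto
  qed
  define m where "m = (INF x\<in>X. measure M (H x))"
  have m_le: "m \<le> measure M (H x)" if "x \<in> X" for x
    unfolding m_def by (rule cINF_lower) (use that in \<open>auto intro!: bdd_belowI[of _ 0]\<close>)
  have "\<exists>x\<in>X. measure M (H x) < m + inverse (Suc n)" for n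
    unfolding m_def by (subst cINF_less_iff[symmetric]) (auto simp: ne intro!: bdd_belowI[of _ 0])
  then obtain s where s: "\<And>n. s n \<in> X" "\<And>n. measure M (H (s n)) < m + inverse (Suc n)"
    by metis
  obtain x and r :: "nat \<Rightarrow> nat" where x: "x \<in> X" and r: "strict_mono r" and lim: "(s \<circ> r) \<longlonglongrightarrow> x"
    using cpt s(1) unfolding compact_def by metis
  have minimal: "measure M K = m"
    if K: "K \<in> components (X - band x e)" and e: "0 < e" and heavy: "measure M X / 2 < measure M K" for K e
  proof (rule antisym)
    \<comment> \<open>Lower bound: \<open>K\<close> is also a component of the complement of the
      contour through some \<open>y\<close>, so it contains the competitor
      \<open>H y\<close>.\<close>
    obtain y where y: "y \<in> X" "K \<in> components (X - band y 0)"
      using component_of_contour_complement[OF K x e] by blast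
    have "H y \<subseteq> K"
      by (rule heavy_sub[OF H[OF y(1)] y(2)]) (use heavy heavyH y in auto)
    then have "measure M (H y) \<le> measure M K"
      using comp_sets[OF K] by (intro M.finite_measure_mono)
    then show "m \<le> measure M K" using m_le[OF y(1)] by simp
  next
    \<comment> \<open>Upper bound: the points \<open>s (r k)\<close> eventually enter the band at
      \<open>x\<close>. Their contours then lie in the band, so \<open>K\<close> is contained in
      \<open>H (s (r k))\<close>, whose measure tends to \<open>m\<close>.\<close>
    have "x \<in> band x e" "\<bar>f x - f x\<bar> < e" using band_self x e by auto
    then obtain V where V: "openin (top_of_set X) V" "x \<in> V" "V \<subseteq> band x e"
      by (rule band_neighbourhood)
    obtain T where T: "open T" "V = X \<inter> T" using V(1) openin_open by blast
    have "\<forall>\<^sub>F k in sequentially. (s \<circ> r) k \<in> T"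
      using lim T V(2) topological_tendstoD by blast
    then obtain N where N: "\<And>k. N \<le> k \<Longrightarrow> s (r k) \<in> band x e"
      using T V(3) s(1) unfolding eventually_sequentially by auto
    have le: "measure M K \<le> m + inverse (Suc k)" if k: "N \<le> k" for k
    proof -
      have "K \<subseteq> H (s (r k))"
        by (rule heavy_sub[OF K H[OF s(1)] heavy heavyH[OF s(1)] band_0_subset[OF N[OF k]]])
      then have "measure M K \<le> measure M (H (s (r k)))"
        using comp_sets[OF H[OF s(1)]] by (intro M.finite_measure_mono)
      also have "\<dots> \<le> m + inverse (Suc (r k))" using s(2) less_imp_le by blast
      also have "\<dots> \<le> m + inverse (Suc k)"
        using seq_suble[OF r, of k] by (simp add: field_simps)
      finally show ?thesis .
    qed
    have "(\<lambda>k. m + inverse (Suc k)) \<longlonglongrightarrow> m + 0"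
      by (intro tendsto_intros LIMSEQ_inverse_real_of_nat)
    then show "measure M K \<le> m"
      using le LIMSEQ_le_const[of _ "m + 0"] by auto
  qed
  \<comment> \<open>Two nested bands with heavy complementary components; the bound 1 on the first
    width is arbitrary.\<close>
  obtain e K where K: "0 < e" "K \<in> components (X - band x e)" "measure M X / 2 < measure M K"
    by (rule component_approximation[OF M x H[OF x] heavyH[OF x] _ zero_less_one]) auto
  obtain d L where L: "0 < d" "d < e" "L \<in> components (X - band x d)" "measure M X / 2 < measure M L"
    by (rule component_approximation[OF M x H[OF x] heavyH[OF x] _ K(1)]) auto
  have de: "band x d \<subseteq> band x e" using L by (intro band_mono) simp
  have KL: "K \<subseteq> L" by (rule heavy_sub[OF K(2) L(3) K(3) L(4) de])
  have LX: "L \<subseteq> X - band x d" using in_components_subset[OF L(3)] .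
  \<comment> \<open>On the frontier of \<open>K\<close> the value of \<open>f\<close> differs from
    \<open>f x\<close> by exactly \<open>e\<close>, which exceeds \<open>d\<close>; so the closure
    of \<open>K\<close> still avoids the smaller band.\<close>
  have cK: "closure K \<subseteq> L"
  proof (rule components_maximal[OF L(3)])
    show "connected (closure K)"
      using K(2) in_components_connected connected_imp_connected_closure by blast
    show "closure K \<subseteq> X - band x d"
      using component_frontier[OF K(2)] band_le[of _ x d] L(2) LX KL by fastforce
    show "L \<inter> closure K \<noteq> {}"
      using KL closure_subset in_components_nonempty[OF K(2)] by blast
  qed
  have opL: "openin (top_of_set X) L"
    by (rule openin_component[OF L(3) closed_band])
  have "closure K \<noteq> L"
  proof
    assume "closure K = L"
    then have "closed L" by (metis closed_closure)
    then have "L = X" using clopen_X opL in_components_nonempty[OF L(3)] by blast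
    then show False using LX x band_self[OF x, of d] L(1) by auto
  qed
  \<comment> \<open>The gap between \<open>closure K\<close> and \<open>L\<close> is relatively open
    and nonempty, hence has positive mass, whereas \<open>minimal\<close> gives \<open>K\<close> and
    \<open>L\<close> equal mass.\<close>
  then have "0 < measure M (L - closure K)"
    using cK opL by (intro pos) (auto simp: Diff_eq intro!: openin_Int_open)
  also have "measure M (L - closure K) \<le> measure M (L - K)"
    using comp_sets[OF L(3)] comp_sets[OF K(2)] closure_subset
    by (intro M.finite_measure_mono) auto
  also have "\<dots> = measure M L - measure M K"
    using comp_sets[OF L(3)] comp_sets[OF K(2)] KL by (intro M.finite_measure_Diff)
  also have "\<dots> = 0"
    using minimal[OF K(2,1,3)] minimal[OF L(3,1,4)] by simp
  finally show False by simp
qed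

end

subsection \<open>Small subsets of the circle\<close>

lemma dist_cis: "dist (cis s) (cis t) ^ 2 = 2 - 2 * cos (s - t)"
proof -
  have "dist (cis s) (cis t) ^ 2 = (cos s - cos t)\<^sup>2 + (sin s - sin t)\<^sup>2"
    by (simp add: dist_norm cmod_power2)
  also have "\<dots> = (cos s ^ 2 + sin s ^ 2) + (cos t ^ 2 + sin t ^ 2) - 2 * (cos s * cos t + sin s * sin t)"
    by (simp add: power2_eq_square algebra_simps)
  finally show ?thesis by (simp add: cos_diff)
qed

lemma dist_cis_less_sqrt3: "dist (cis s) (cis t) < sqrt 3 \<longleftrightarrow> - 1 / 2 < cos (s - t)"
proof -
  have "dist (cis s) (cis t) < sqrt 3 \<longleftrightarrow> dist (cis s) (cis t) ^ 2 < sqrt 3 ^ 2"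
    using power_mono_iff[of "sqrt 3" "dist (cis s) (cis t)" 2] by (simp add: not_le[symmetric] del: real_sqrt_pow2)
  then show ?thesis by (simp add: dist_cis) argo
qed

lemma cos_120: "cos (2 * pi / 3) = - 1 / 2"
  using cos_minus_pi[of "pi / 3"] cos_minus[of "2 * pi / 3"] by (simp add: cos_60 field_simps)

text \<open>The bound is where cosine next returns to \<open>- 1 / 2\<close> after
  \<open>2 * pi / 3\<close>; in between it stays below that value.\<close>

lemma cos_gt_minus_half:
  fixes t :: real
  assumes "\<bar>t\<bar> < 4 * pi / 3"
  shows "- 1 / 2 < cos t \<longleftrightarrow> \<bar>t\<bar> < 2 * pi / 3"
proof -
  have c: "cos t = cos \<bar>t\<bar>" by simp
  show ?thesis
  proof (cases "\<bar>t\<bar> \<le> pi")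
    case True
    then have "cos (2 * pi / 3) < cos \<bar>t\<bar> \<longleftrightarrow> \<bar>t\<bar> < 2 * pi / 3"
      by (intro cos_mono_less_eq) auto
    then show ?thesis by (simp only: cos_120 c)
  next
    case False
    have "cos (2 * pi - \<bar>t\<bar>) < cos (2 * pi / 3)"
      using False assms by (intro cos_monotone_0_pi) linarith+
    moreover have "cos (2 * pi - \<bar>t\<bar>) = cos \<bar>t\<bar>" by (simp add: cos_diff)
    ultimately have "cos t < - 1 / 2" by (simp only: cos_120 c)
    then show ?thesis using False pi_gt_zero by linarith
  qed
qed

lemma cis_eq_imp_ge_2pi:
  assumes "cis s = cis t" "s < t"
  shows "s + 2 * pi \<le> t"
proof (rule ccontr)
  assume "\<not> ?thesis"
  moreover have "cos (t - s) = 1"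
    using assms(1) by (metis cis.sel cos_diff cos_zero diff_self)
  then obtain n :: int where "t - s = of_int n * (2 * pi)"
    unfolding cos_one_2pi_int by (auto simp: mult.assoc)
  ultimately have "0 < of_int n * (2 * pi)" "of_int n * (2 * pi) < of_int 1 * (2 * pi)"
    using assms(2) by linarith+
  then have "(0::real) < of_int n" "real_of_int n < of_int 1"
    by (simp_all only: zero_less_mult_iff mult_less_cancel_right) (use pi_gt_zero in linarith)+
  then show False by simp
qed

text \<open>Measure angles from a point \<open>p\<close> of \<open>D\<close>. All of them are below
  \<open>2 * pi / 3\<close> in absolute value, so the extreme angles \<open>a\<close> and
  \<open>b\<close> differ by less than \<open>4 * pi / 3\<close>. As their points are closer than
  \<open>sqrt 3\<close>, the difference is even below \<open>2 * pi / 3\<close>, and the arc from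
  \<open>a\<close> to \<open>b\<close> serves as \<open>A\<close>.\<close>

lemma circle_subset_arc:
  fixes D :: "complex set"
  assumes "D \<subseteq> sphere 0 1" "compact D" "\<And>x y. x \<in> D \<Longrightarrow> y \<in> D \<Longrightarrow> dist x y < sqrt 3"
  obtains A where "D \<subseteq> A" "A \<subseteq> sphere 0 1" "compact A" "connected (sphere 0 1 - A)"
    "\<And>x y. x \<in> A \<Longrightarrow> y \<in> A \<Longrightarrow> dist x y < sqrt 3"
proof (cases "D = {}")
  case True
  show ?thesis by (rule that[of "{}"]) (auto simp: True connected_sphere)
next
  case False
  then obtain p where p: "p \<in> D" by blast
  then have np: "cmod p = 1" using assms(1) by auto
  define g where "g t = p * cis t" for t
  have g_dist: "dist (g s) (g t) = dist (cis s) (cis t)" for s t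
    by (simp add: g_def dist_norm np norm_mult flip: right_diff_distrib)
  have g_sphere: "g t \<in> sphere 0 1" for t by (simp add: g_def np norm_mult)
  have g_onto: "\<exists>t. g t = z \<and> - pi < t \<and> t \<le> pi" if "z \<in> sphere 0 1" for z
  proof -
    have "cis (Arg (z / p)) = z / p"
      using that np by (subst cis_Arg) (auto simp: norm_divide sgn_div_norm)
    then show ?thesis using np Arg_bounded[of "z / p"] by (intro exI[of _ "Arg (z / p)"]) (auto simp: g_def)
  qed
  have g_cont: "continuous_on S g" for S unfolding g_def by (intro continuous_intros)
  have g_2pi: "g (t - 2 * pi) = g t" for t
    by (simp add: g_def flip: cis_divide)
  have g_eq: "cis s = cis t" if "g s = g t" for s t
    using that np by (auto simp: g_def)
  define T where "T = {-pi..pi} \<inter> g -` D"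
  have "closed T"
    unfolding T_def using continuous_closed_preimage[OF g_cont] assms(2) compact_imp_closed by blast
  moreover have "bounded T" unfolding T_def using bounded_closed_interval bounded_subset by blast
  ultimately have "compact T" by (simp add: compact_eq_bounded_closed)
  have 0: "0 \<in> T" using p by (simp add: T_def g_def)
  obtain a where a: "a \<in> T" "\<And>t. t \<in> T \<Longrightarrow> a \<le> t"
    using compact_attains_inf[OF \<open>compact T\<close>] 0 by blast
  obtain b where b: "b \<in> T" "\<And>t. t \<in> T \<Longrightarrow> t \<le> b"
    using compact_attains_sup[OF \<open>compact T\<close>] 0 by blast
  have half: "- 1 / 2 < cos (s - t)" if "s \<in> T" "t \<in> T" for s t
    using that assms(3)[of "g s" "g t"] by (simp add: T_def g_dist dist_cis_less_sqrt3)
  have small: "\<bar>t\<bar> < 2 * pi / 3" if "t \<in> T" for t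
  proof -
    have "\<bar>t\<bar> \<le> pi" using that by (auto simp: T_def)
    then have "\<bar>t\<bar> < 4 * pi / 3" using pi_gt_zero by linarith
    then show ?thesis using half[OF that 0] cos_gt_minus_half by simp
  qed
  from small[OF a(1)] small[OF b(1)] have "\<bar>b - a\<bar> < 4 * pi / 3" by linarith
  then have ba: "b - a < 2 * pi / 3" "a \<le> b"
    using half[OF b(1) a(1)] cos_gt_minus_half[of "b - a"] a b by auto
  define A where "A = g ` {a..b}"
  \<comment> \<open>Angles below \<open>a\<close> are moved up by a full turn, which makes the
    complement the image of a single open interval.\<close>
  have "sphere 0 1 - A = g ` {b<..<a + 2 * pi}"
  proof (intro equalityI subsetI)
    fix z assume "z \<in> sphere 0 1 - A"
    then obtain t where t: "g t = z" "- pi < t" "t \<le> pi" and zA: "z \<notin> A" using g_onto by blast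
    have "t \<notin> {a..b}" using zA t A_def by blast
    moreover have "a + 2 * pi \<noteq> t + 2 * pi" using calculation ba by auto
    moreover have "g (t + 2 * pi) = g t" using g_2pi[of "t + 2 * pi"] by simp
    moreover have "- pi < a" "b \<le> pi" using small[OF a(1)] b by (auto simp: T_def)
    ultimately have "t \<in> {b<..<a + 2 * pi} \<or> t + 2 * pi \<in> {b<..<a + 2 * pi}"
      using t by auto
    then show "z \<in> g ` {b<..<a + 2 * pi}"
      using t \<open>g (t + 2 * pi) = g t\<close> by (metis image_eqI)
  next
    fix z assume "z \<in> g ` {b<..<a + 2 * pi}"
    then obtain t where t: "z = g t" "b < t" "t < a + 2 * pi" by auto
    have "z \<notin> A"
    proof
      assume "z \<in> A"
      then obtain s where s: "g s = g t" "a \<le> s" "s \<le> b" using t by (auto simp: A_def)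
      then show False using cis_eq_imp_ge_2pi[OF g_eq[OF s(1)]] t by linarith
    qed
    then show "z \<in> sphere 0 1 - A" using g_sphere t by auto
  qed
  then have "connected (sphere 0 1 - A)"
    by (simp add: connected_continuous_image g_cont)
  moreover have "D \<subseteq> A"
  proof
    fix z assume z: "z \<in> D"
    then obtain t where t: "g t = z" "- pi < t" "t \<le> pi" using g_onto assms(1) by blast
    then have "t \<in> T" using z by (simp add: T_def)
    then show "z \<in> A" using t a b unfolding A_def by (intro image_eqI[of _ _ t]) auto
  qed
  moreover have "dist x y < sqrt 3" if xy: "x \<in> A" "y \<in> A" for x y
  proof -
    obtain s t where st: "x = g s" "y = g t" "s \<in> {a..b}" "t \<in> {a..b}" using xy by (auto simp: A_def)
    then have "\<bar>s - t\<bar> < 2 * pi / 3" using ba unfolding abs_less_iff atLeastAtMost_iff by linarith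
    then have "- 1 / 2 < cos (s - t)" using cos_gt_minus_half[of "s - t"] pi_gt_zero by auto
    then show ?thesis by (simp add: st g_dist dist_cis_less_sqrt3)
  qed
  moreover have "compact A" unfolding A_def by (intro compact_continuous_image g_cont) auto
  moreover have "A \<subseteq> sphere 0 1" using g_sphere by (auto simp: A_def)
  ultimately show ?thesis using that by blast
qed

subsection \<open>Lebesgue measure projected along a retraction\<close>

text \<open>Used with radial maps \<open>r\<close>. For the sphere, \<open>sgn\<close> gives an
  antipodally symmetric measure. For the disc, the annulus outside it collapses onto the circle; a
  radius above 2 puts enough mass there, and 3 gives circle and open disc the ratio 8 to 1.\<close>

definition projected_measure :: "('a::euclidean_space \<Rightarrow> 'a) \<Rightarrow> 'a measure" where
  "projected_measure r = distr (restrict_space lborel (ball 0 3)) borel r"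

lemma
  fixes r :: "'a::euclidean_space \<Rightarrow> 'a"
  assumes r: "r \<in> borel_measurable borel"
  shows finite_measure_projected_measure: "finite_measure (projected_measure r)"
    and sets_projected_measure: "sets (projected_measure r) = sets borel"
    and measure_projected_measure:
      "A \<in> sets borel \<Longrightarrow> measure (projected_measure r) A = measure lborel (r -` A \<inter> ball 0 3)"
proof -
  have r': "r \<in> borel_measurable (restrict_space lborel (ball 0 3))"
    using r by (intro measurable_restrict_space1) simp
  have "emeasure (restrict_space lborel (ball (0::'a) 3)) (ball 0 3) \<noteq> \<infinity>"
    by (subst emeasure_restrict_space) (auto simp: emeasure_ball)
  then have "finite_measure (restrict_space lborel (ball (0::'a) 3))"
    by (intro finite_measureI) (simp add: space_restrict_space)
  then show "finite_measure (projected_measure r)"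
    unfolding projected_measure_def by (rule finite_measure.finite_measure_distr) (rule r')
  show "sets (projected_measure r) = sets borel" by (simp add: projected_measure_def)
  assume A: "A \<in> sets borel"
  have "measure (projected_measure r) A = measure (restrict_space lborel (ball 0 3)) (r -` A \<inter> ball 0 3)"
    unfolding projected_measure_def by (subst measure_distr[OF r' A]) (simp add: space_restrict_space)
  also have "\<dots> = measure lborel (r -` A \<inter> ball 0 3)"
    by (rule measure_restrict_space) auto
  finally show "measure (projected_measure r) A = measure lborel (r -` A \<inter> ball 0 3)" .
qed

text \<open>\<open>r\<close> fixes each point \<open>z\<close> of \<open>U\<close> and is continuous
  near it, so it maps a small ball around \<open>z\<close> into \<open>U\<close>. The open set
  \<open>W\<close> allows \<open>r\<close> to be discontinuous elsewhere, as \<open>sgn\<close> is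
  at the origin.\<close>

lemma projected_measure_pos:
  assumes r: "r \<in> borel_measurable borel" and W: "open W" "continuous_on W r"
    and X: "closed X" "X \<subseteq> W \<inter> ball 0 3" "r ` W \<subseteq> X" "\<And>x. x \<in> X \<Longrightarrow> r x = x"
    and U: "openin (top_of_set X) U" "U \<noteq> {}"
  shows "0 < measure (projected_measure r) U"
proof -
  obtain T where T: "open T" "U = X \<inter> T" using U(1) openin_open by blast
  obtain z where z: "z \<in> U" using U(2) by blast
  have Ub: "U \<in> sets borel" using T X(1) by auto
  define V where "V = (W \<inter> r -` T) \<inter> ball 0 3"
  have V: "open V" "z \<in> V" "V \<subseteq> r -` U \<inter> ball 0 3"
    unfolding V_def using z T X W continuous_open_preimage[OF W(2,1) T(1)] by auto
  obtain e where e: "0 < e" "ball z e \<subseteq> V" using V(1,2) open_contains_ball by blast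
  have "0 < measure lborel (ball z e)" using e by simp
  also have "\<dots> \<le> measure lborel (r -` U \<inter> ball 0 3)"
  proof (rule measure_mono_fmeasurable)
    have "r -` U \<in> sets borel" using measurable_sets[OF r Ub] by simp
    then show "r -` U \<inter> ball 0 3 \<in> fmeasurable lborel"
      by (subst Int_commute, intro fmeasurable_Int_fmeasurable)
         (auto intro!: fmeasurableI simp: emeasure_ball)
    show "ball z e \<subseteq> r -` U \<inter> ball 0 3" using e V by blast
  qed auto
  finally show ?thesis by (simp add: measure_projected_measure[OF r Ub])
qed

lemma measure_lborel_uminus:
  fixes A :: "'a::euclidean_space set"
  assumes "A \<in> sets borel"
  shows "measure lborel (uminus -` A) = measure lborel A"
proof -
  have "lborel = distr lborel borel (uminus :: 'a \<Rightarrow> 'a)"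
    using lborel_affine[of "-1" "0::'a"] by (simp add: density_1)
  then have "measure lborel A = measure (distr lborel borel uminus) A" by (rule arg_cong)
  also have "\<dots> = measure lborel (uminus -` A)"
    using assms measure_distr[of uminus lborel borel A] by simp
  finally show ?thesis by simp
qed

subsection \<open>Contours of the sphere and the disc\<close>

lemma sphere_antipodal_contour:
  fixes f :: "'a::euclidean_space \<Rightarrow> real"
  assumes dim: "3 \<le> DIM('a)" and cont: "continuous_on (sphere 0 1) f"
  obtains x where "norm x = 1" "connected_component {z \<in> sphere 0 1. f z = f x} x (- x)"
proof -
  let ?S = "sphere (0::'a) 1"
  interpret unicoherent_continuum ?S f
    using dim cont
    by unfold_locales (auto intro: connected_sphere locally_path_connected_sphere
        Borsukian_imp_unicoherent Borsukian_sphere)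
  define M where "M = projected_measure (sgn :: 'a \<Rightarrow> 'a)"
  have M: "finite_measure M" "sets M = sets borel"
    unfolding M_def by (simp_all add: finite_measure_projected_measure sets_projected_measure)
  interpret M: finite_measure M by (rule M)
  have "?S \<noteq> {}" by simp
  moreover have pos: "0 < measure M U" if "openin (top_of_set ?S) U" "U \<noteq> {}" for U
    unfolding M_def
  proof (rule projected_measure_pos[OF _ _ _ _ _ _ _ that])
    show "continuous_on (- {0::'a}) sgn"
      by (intro continuous_on_sgn continuous_on_id) auto
    show "sgn x = x" if "x \<in> ?S" for x :: 'a
      using that by (simp add: sgn_div_norm)
  qed (auto simp: norm_sgn split: if_splits)
  ultimately obtain x where x: "x \<in> ?S"
    and half: "\<And>U. U \<in> components (?S - band x 0) \<Longrightarrow> measure M U \<le> measure M ?S / 2"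
    using median_contour[OF M] by blast
  have minus: "measure M (uminus ` A) = measure M A" if A: "A \<in> sets borel" for A
  proof -
    have B: "sgn -` A \<inter> ball 0 3 \<in> sets borel"
      using measurable_sets[OF borel_measurable_sgn A] by auto
    have "uminus ` A = uminus -` A" by (auto simp: image_iff) (metis minus_minus)
    moreover have "uminus -` A \<in> sets borel"
      using measurable_sets[of uminus borel borel A] A by simp
    moreover have "sgn -` uminus -` A \<inter> ball 0 3 = uminus -` (sgn -` A \<inter> ball 0 3)"
      by (auto simp: sgn_minus)
    ultimately show ?thesis
      using measure_lborel_uminus[OF B] A by (simp add: M_def measure_projected_measure)
  qed
  have uminus_S: "uminus ` ?S = ?S"
    by (auto simp: image_iff intro!: bexI[of _ "- _"])
  let ?C = "band x 0"
  have "\<exists>y\<in>?C. - y \<in> ?C"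
  proof (rule ccontr)
    assume no: "\<not> (\<exists>y\<in>?C. - y \<in> ?C)"
    have conn_minus: "connected (uminus ` A)" if "connected A" for A :: "'a set"
      using that by (intro connected_continuous_image continuous_intros)
    have sub: "uminus ` ?C \<subseteq> ?S - ?C"
      using no band_subset[of x 0] by auto
    then obtain U where U: "U \<in> components (?S - ?C)" "uminus ` ?C \<subseteq> U"
      using exists_component_superset[OF sub _ conn_minus[OF connected_band]] band_self[OF x, of 0] by auto
    define V where "V = ?S - U"
    have US: "U \<subseteq> ?S - ?C" using U(1) by (rule in_components_subset)
    have "connected V"
      unfolding V_def by (rule component_diff_connected[OF connected_band conn band_subset U(1)])
    then have "connected (uminus ` V)" by (rule conn_minus)
    \<comment> \<open>\<open>V\<close> misses the antipode of \<open>?C\<close>, which lies in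
      \<open>U\<close>; hence the antipode of \<open>V\<close> misses \<open>?C\<close>.\<close>
    moreover have subV: "uminus ` V \<subseteq> ?S - ?C"
      using U(2) by (auto simp: V_def image_iff)
    ultimately obtain W where W: "W \<in> components (?S - ?C)" "uminus ` V \<subseteq> W"
      using exists_component_superset[of "uminus ` V" "?S - ?C"] US in_components_nonempty[OF U(1)] by blast
    have opW: "openin (top_of_set ?S) W" by (rule openin_component[OF W(1) closed_band])
    have opU: "openin (top_of_set ?S) U" by (rule openin_component[OF U(1) closed_band])
    obtain G where G: "open G" "U = ?S \<inter> G" using opU openin_open by blast
    then have "V = ?S - G" by (auto simp: V_def)
    then have "closed V" using G(1) closed_X by (simp add: closed_Diff)
    then have clV: "closed (uminus ` V)" by (rule closed_negations)
    have "x \<in> V" using x US band_self[OF x, of 0] by (auto simp: V_def)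
    have "uminus ` V \<noteq> W"
    proof
      assume eq: "uminus ` V = W"
      then have "W = ?S" using clopen_X[OF opW] clV \<open>x \<in> V\<close> by auto
      then show False using in_components_subset[OF W(1)] band_self[OF x, of 0] x by auto
    qed
    \<comment> \<open>\<open>V\<close> has at least half of the mass because \<open>U\<close> has at
      most half. \<open>W\<close> exceeds the antipode of \<open>V\<close> by a nonempty open set,
      so it has more than half.\<close>
    then have "0 < measure M (W - uminus ` V)"
      using W(2) clV opW by (intro pos) (auto simp: Diff_eq intro!: openin_Int_open)
    also have "\<dots> = measure M W - measure M (uminus ` V)"
      using W clV borel_component[OF W(1) closed_band] M(2) by (intro M.finite_measure_Diff) auto
    also have "measure M (uminus ` V) = measure M V"
      using \<open>closed V\<close> by (intro minus) auto
    also have "measure M V = measure M ?S - measure M U"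
      unfolding V_def using US borel_component[OF U(1) closed_band] M(2)
      by (intro M.finite_measure_Diff) auto
    finally show False using half[OF U(1)] half[OF W(1)] by simp
  qed
  then obtain y where y: "y \<in> ?C" "- y \<in> ?C" by blast
  have "connected_component {z \<in> ?S. f z = f y} y (- y)"
  proof (rule connected_componentI[of ?C])
    show "?C \<subseteq> {z \<in> ?S. f z = f y}"
      using band_le[of _ x 0] band_subset[of x 0] y(1) by fastforce
  qed (use y in auto)
  moreover have "norm y = 1" using y band_subset by fastforce
  ultimately show ?thesis using that by blast
qed

section \<open>The disc: rotation by 120 degrees and wide contours\<close>

lemma isometry_complex:
  "\<exists>(h :: real^2 \<Rightarrow> complex) g. linear h \<and> linear g \<and> (\<forall>x. norm (h x) = norm x) \<and>
    (\<forall>y. norm (g y) = norm y) \<and> (\<forall>x. g (h x) = x) \<and> (\<forall>y. h (g y) = y)"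
proof (rule isomorphisms_UNIV_UNIV[where 'M="real^2" and 'N=complex])
  show "DIM(real^2) = DIM(complex)" by simp
qed blast

text \<open>The index type 2, unlike an arbitrary two-element type, is wellordered, as
  \<open>measure_orthogonal_image\<close> requires.\<close>

lemma rotation_120_exists:
  obtains T :: "real^2 \<Rightarrow> real^2"
  where "orthogonal_transformation T" "\<And>x. T (T (T x)) = x" "\<And>x. norm x = 1 \<Longrightarrow> dist x (T x) = sqrt 3"
proof -
  obtain h :: "real^2 \<Rightarrow> complex" and g where hg: "linear h" "linear g" "\<And>x. norm (h x) = norm x"
      "\<And>y. norm (g y) = norm y" "\<And>x. g (h x) = x" "\<And>y. h (g y) = y"
    using isometry_complex by blast
  \<comment> \<open>A primitive cube root of unity; its distance from 1 is \<open>sqrt 3\<close>,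
    the side of the inscribed equilateral triangle.\<close>
  define w where "w = cis (2 * pi / 3)"
  define T where "T x = g (w * h x)" for x
  have w3: "w * (w * w) = 1" by (simp add: w_def cis_mult)
  have "linear ((*) w)" by (rule linear_times)
  then have "linear (g \<circ> ((*) w \<circ> h))" using hg by (intro linear_compose) auto
  moreover have "g \<circ> ((*) w \<circ> h) = T" by (simp add: T_def fun_eq_iff)
  ultimately have "linear T" by simp
  then have orth: "orthogonal_transformation T"
    unfolding orthogonal_transformation by (simp add: T_def hg norm_mult w_def)
  have "T (T (T x)) = x" for x
    using w3 by (simp add: T_def hg flip: mult.assoc)
  moreover have "dist x (T x) = sqrt 3" if "norm x = 1" for x
  proof -
    have "dist x (T x) = norm (h x - h (T x))"
      using hg by (metis dist_norm linear_diff)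
    also have "h x - h (T x) = (1 - w) * h x" by (simp add: T_def hg algebra_simps)
    also have "norm \<dots> = dist (cis 0) w" using that by (simp add: norm_mult hg dist_norm)
    also have "\<dots> = sqrt ((dist (cis 0) w)\<^sup>2)" by simp
    also have "(dist (cis 0) w)\<^sup>2 = 3" unfolding w_def dist_cis by (simp add: cos_120)
    finally show ?thesis .
  qed
  ultimately show ?thesis using orth that by blast
qed

lemma circle_subset_arc_real2:
  fixes D :: "(real^2) set"
  assumes "D \<subseteq> sphere 0 1" "compact D" "\<And>x y. x \<in> D \<Longrightarrow> y \<in> D \<Longrightarrow> dist x y < sqrt 3"
  obtains A where "D \<subseteq> A" "A \<subseteq> sphere 0 1" "compact A" "connected (sphere 0 1 - A)"
    "\<And>x y. x \<in> A \<Longrightarrow> y \<in> A \<Longrightarrow> dist x y < sqrt 3"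
proof -
  obtain h :: "real^2 \<Rightarrow> complex" and g where hg: "linear h" "linear g" "\<And>x. norm (h x) = norm x"
      "\<And>y. norm (g y) = norm y" "\<And>x. g (h x) = x" "\<And>y. h (g y) = y"
    using isometry_complex by blast
  have dist_h: "dist (h x) (h y) = dist x y" for x y using hg by (metis dist_norm linear_diff)
  have dist_g: "dist (g x) (g y) = dist x y" for x y using hg by (metis dist_norm linear_diff)
  have cont: "continuous_on S h" "continuous_on S' g" for S S'
    using hg linear_continuous_on linear_conv_bounded_linear by blast+
  obtain A where A: "h ` D \<subseteq> A" "A \<subseteq> sphere 0 1" "compact A" "connected (sphere 0 1 - A)"
    "\<And>x y. x \<in> A \<Longrightarrow> y \<in> A \<Longrightarrow> dist x y < sqrt 3"
  proof (rule circle_subset_arc[of "h ` D"])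
    show "h ` D \<subseteq> sphere 0 1" using assms(1) by (auto simp: hg)
    show "compact (h ` D)" using assms(2) cont compact_continuous_image by blast
  qed (use assms(3) in \<open>auto simp: dist_h\<close>)
  have "sphere 0 1 - g ` A = g ` (sphere 0 1 - A)"
  proof (intro equalityI subsetI)
    fix x assume "x \<in> sphere 0 1 - g ` A"
    then have "h x \<in> sphere 0 1 - A" using hg by (auto simp: image_iff)
    then show "x \<in> g ` (sphere 0 1 - A)" using hg(5) by (metis image_eqI)
  next
    fix x assume "x \<in> g ` (sphere 0 1 - A)"
    then obtain y where y: "x = g y" "norm y = 1" "y \<notin> A" by auto
    have "x \<notin> g ` A" using y hg(6) by (metis image_iff)
    then show "x \<in> sphere 0 1 - g ` A" using y hg by simp
  qed
  then show ?thesis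
  proof (intro that[of "g ` A"])
    show "D \<subseteq> g ` A" using A(1) hg(5) by (metis image_eqI image_subset_iff subsetI)
    show "g ` A \<subseteq> sphere 0 1" using A(2) by (auto simp: hg)
  qed (use A cont in \<open>auto simp: dist_g intro!: compact_continuous_image connected_continuous_image\<close>)
qed

lemma disc_wide_contour:
  fixes f :: "real^2 \<Rightarrow> real"
  assumes cont: "continuous_on (cball 0 1) f"
  obtains C where "contour_of f (cball 0 1) C" "sqrt 3 \<le> diameter (C \<inter> sphere 0 1)"
proof -
  let ?E = "cball (0::real^2) 1" and ?S = "sphere (0::real^2) 1"
  interpret unicoherent_continuum ?E f
    using cont by unfold_locales (auto intro: convex_imp_locally_path_connected convex_imp_unicoherent
        convex_connected)
  \<comment> \<open>The radial retraction of the plane onto the disc; \<open>max\<close> joins the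
    identity inside and normalisation outside in one continuous formula.\<close>
  define r :: "real^2 \<Rightarrow> real^2" where "r y = inverse (max 1 (norm y)) *\<^sub>R y" for y
  have r_cont: "continuous_on UNIV r"
    unfolding r_def by (intro continuous_intros) (auto simp: max_def)
  have r_borel: "r \<in> borel_measurable borel"
    using r_cont by (rule borel_measurable_continuous_onI)
  have r_id: "r y = y" if "norm y \<le> 1" for y using that by (simp add: r_def max_def)
  have norm_r: "norm (r y) = min 1 (norm y)" for y
  proof (cases "norm y \<le> 1")
    case False
    then have "norm y \<noteq> 0" by linarith
    then show ?thesis using False by (simp add: r_def max_def min_def)
  qed (simp add: r_id)
  define M where "M = projected_measure r"
  have M: "finite_measure M" "sets M = sets borel"
    unfolding M_def using r_borel by (simp_all add: finite_measure_projected_measure sets_projected_measure)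
  interpret M: finite_measure M by (rule M)
  have mM: "measure M A = measure lborel (r -` A \<inter> ball 0 3)" if "A \<in> sets borel" for A
    unfolding M_def by (rule measure_projected_measure[OF r_borel that])
  have "?E \<noteq> {}" by simp
  moreover have pos: "0 < measure M U" if "openin (top_of_set ?E) U" "U \<noteq> {}" for U
    unfolding M_def
    by (rule projected_measure_pos[OF r_borel open_UNIV r_cont _ _ _ _ that])
       (auto simp: r_id norm_r)
  ultimately obtain x where x: "x \<in> ?E"
    and half: "\<And>U. U \<in> components (?E - band x 0) \<Longrightarrow> measure M U \<le> measure M ?E / 2"
    using median_contour[OF M] by blast
  define b where "b = measure lborel (ball (0::real^2) 1)"
  have "0 < b" unfolding b_def by simp
  have "measure lborel (ball (0::real^2) 3) = 9 * b"
    by (simp add: b_def content_ball)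
  moreover have "r -` ?E \<inter> ball 0 3 = ball 0 3" by (auto simp: norm_r)
  ultimately have ME: "measure M ?E = 9 * b" by (simp add: mM)
  have "r -` ball 0 1 \<inter> ball 0 3 = ball 0 1" by (auto simp: norm_r min_def split: if_splits)
  then have MB: "measure M (ball 0 1) = b" by (simp add: mM b_def)
  have "?S = ?E - ball 0 1" by auto
  then have MS: "measure M ?S = 8 * b"
    using M.finite_measure_Diff[of ?E "ball 0 1"] M(2) ME MB by auto
  obtain T :: "real^2 \<Rightarrow> real^2" where T: "orthogonal_transformation T" "\<And>x. T (T (T x)) = x"
    and dT: "\<And>x. norm x = 1 \<Longrightarrow> dist x (T x) = sqrt 3"
    using rotation_120_exists by blast
  have linT: "linear T" and normT: "norm (T x) = norm x" for x
    using T(1) unfolding orthogonal_transformation by auto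
  have cpT: "compact (T ` A)" if "compact A" for A
    using that linT by (intro compact_continuous_image linear_continuous_on) (simp_all add: linear_conv_bounded_linear)
  \<comment> \<open>\<open>T\<close> preserves Lebesgue measure and the ball, and commutes with
    \<open>r\<close>, so the preimage of a rotated set is the rotated preimage.\<close>
  have MT: "measure M (T ` A) = measure M A" if A: "compact A" for A
  proof -
    have sb: "r -` A \<inter> ball 0 3 \<in> sets borel" if "compact A" for A
      using measurable_sets[OF r_borel, of A] that borel_compact[OF that] by auto
    have rT: "r (T y) = T (r y)" for y
      using linT by (simp add: r_def normT linear_scale)
    have "r -` (T ` A) \<inter> ball 0 3 = T ` (r -` A \<inter> ball 0 3)"
    proof (intro equalityI subsetI)
      fix y assume y: "y \<in> r -` (T ` A) \<inter> ball 0 3"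
      \<comment> \<open>Applying \<open>T\<close> twice inverts \<open>T\<close>.\<close>
      have "r (T (T y)) = T (T (r y))" by (simp add: rT)
      then have "T (T y) \<in> r -` A \<inter> ball 0 3" using y T(2) by (auto simp: normT)
      then show "y \<in> T ` (r -` A \<inter> ball 0 3)" using T(2) by (metis image_eqI)
    qed (auto simp: normT rT)
    moreover have "measure lebesgue (T ` (r -` A \<inter> ball 0 3)) = measure lebesgue (r -` A \<inter> ball 0 3)"
      using sb[OF A] by (intro measure_orthogonal_image T(1) bounded_set_imp_lmeasurable)
        (auto intro: bounded_subset[OF bounded_ball])
    ultimately show ?thesis
      using sb[OF A] sb[OF cpT[OF A]] A cpT[OF A]
      by (simp add: mM borel_compact measure_completion)
  qed
  let ?C = "band x 0" and ?D = "band x 0 \<inter> ?S"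
  have "sqrt 3 \<le> diameter ?D"
  proof (rule ccontr)
    assume less: "\<not> sqrt 3 \<le> diameter ?D"
    have cD: "compact ?D" by (intro compact_Int compact_band) simp
    have "dist u v < sqrt 3" if "u \<in> ?D" "v \<in> ?D" for u v
      using diameter_bounded_bound[OF compact_imp_bounded[OF cD] that] less by linarith
    then obtain A where A: "?D \<subseteq> A" "A \<subseteq> ?S" "compact A" "connected (?S - A)"
      and dA: "\<And>x y. x \<in> A \<Longrightarrow> y \<in> A \<Longrightarrow> dist x y < sqrt 3"
      using circle_subset_arc_real2[of ?D] cD by (metis inf_le2)
    \<comment> \<open>Points of \<open>A\<close> are closer than \<open>sqrt 3\<close>, but a unit
      vector and its rotated image are at distance exactly \<open>sqrt 3\<close>. So the three
      rotated copies of \<open>A\<close> are disjoint, and \<open>A\<close> has at most a third of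
      the mass of the circle.\<close>
    have disj1: "A \<inter> T ` A = {}"
    proof -
      have "T y \<notin> A" if "y \<in> A" for y using dA[OF that, of "T y"] dT[of y] A(2) that by auto
      then show ?thesis by auto
    qed
    have disj2: "T ` A \<inter> T ` T ` A = {}"
    proof -
      have "inj T" by (metis T(2) injI)
      then show ?thesis using disj1 by (metis image_Int image_empty)
    qed
    have disj3: "A \<inter> T ` T ` A = {}"
    proof -
      have "T (T y) \<notin> A" if "y \<in> A" for y
        using dA[OF _ that, of "T (T y)"] dT[of "T (T y)"] T(2)[of y] A(2) that by (auto simp: normT)
      then show ?thesis by auto
    qed
    have Ab: "A \<in> sets M" "T ` A \<in> sets M" "T ` T ` A \<in> sets M"
      using A(3) cpT borel_compact M(2) by auto
    have "measure M (A \<union> T ` A \<union> T ` T ` A) = measure M A + measure M (T ` A) + measure M (T ` T ` A)"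
      using Ab disj1 disj2 disj3 by (simp add: M.finite_measure_Union Int_Un_distrib2)
    also have "\<dots> = 3 * measure M A" using MT A(3) cpT by simp
    finally have "3 * measure M A = measure M (A \<union> T ` A \<union> T ` T ` A)" ..
    also have "\<dots> \<le> measure M ?S"
      using A(2) M(2) by (intro M.finite_measure_mono) (auto simp: normT)
    finally have MA: "3 * measure M A \<le> 8 * b" by (simp add: MS)
    have "?S - A \<noteq> {}"
    proof
      assume "?S - A = {}"
      then have "A = ?S" using A(2) by auto
      moreover have "T ` ?S \<subseteq> ?S" by (auto simp: normT)
      ultimately have "?S = {}" using disj1 by blast
      then show False by simp
    qed
    moreover have SA: "?S - A \<subseteq> ?E - ?C" using A(1) by auto
    ultimately obtain U where U: "U \<in> components (?E - ?C)" "?S - A \<subseteq> U"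
      using exists_component_superset[OF SA _ A(4)] by blast
    have Ub: "U \<in> sets M" using borel_component[OF U(1) closed_band] M(2) by simp
    have UE: "U \<subseteq> ?E" using in_components_subset[OF U(1)] by auto
    \<comment> \<open>Outside \<open>U\<close> lies at most mass \<open>b\<close> from the open disc
      and \<open>8 * b / 3\<close> from \<open>A\<close>, together \<open>11 * b / 3\<close>. This
      is less than half of \<open>9 * b\<close>, so \<open>U\<close> is too heavy.\<close>
    have "measure M ?E - measure M U = measure M (?E - U)"
      using Ub UE M(2) by (intro M.finite_measure_Diff[symmetric]) auto
    also have "\<dots> \<le> measure M (ball 0 1 \<union> A)"
      using U(2) A(3) borel_compact[OF A(3)] M(2) by (intro M.finite_measure_mono) auto
    also have "\<dots> \<le> measure M (ball 0 1) + measure M A"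
      using Ab(1) M(2) by (intro measure_Un_le) auto
    finally show False using half[OF U(1)] MA MB ME \<open>0 < b\<close> by simp
  qed
  then show ?thesis using contour_of_band[OF x] that by blast
qed

section \<open>Transport to unit balls with arbitrary centre\<close>

lemma contour_of_image:
  assumes C: "contour_of (\<lambda>x. f (\<phi> x)) X C" and hom: "homeomorphism X Y \<phi> \<psi>"
  shows "contour_of f Y (\<phi> ` C)"
proof -
  obtain y where y: "C \<in> components {x \<in> X. f (\<phi> x) = y}"
    using C by (auto simp: contour_of_def)
  then have sub: "C \<subseteq> {x \<in> X. f (\<phi> x) = y}" "connected C" "C \<noteq> {}"
    using in_components_subset in_components_connected in_components_nonempty by blast+
  have \<phi>: "\<phi> x \<in> Y" "\<psi> (\<phi> x) = x" if "x \<in> X" for x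
    using hom that unfolding homeomorphism_def by auto
  have \<psi>: "\<psi> w \<in> X" "\<phi> (\<psi> w) = w" if "w \<in> Y" for w
    using hom that unfolding homeomorphism_def by auto
  have "\<phi> ` C \<in> components {w \<in> Y. f w = y}"
    unfolding in_components_maximal
  proof (intro conjI allI impI; (elim conjE)?)
    show "connected (\<phi> ` C)"
      using sub by (intro connected_continuous_image continuous_on_subset[OF homeomorphism_cont1[OF hom]]) auto
    \<comment> \<open>Maximality is checked by pulling a larger connected set back along
      \<open>\<psi>\<close>.\<close>
    fix D assume D: "D \<noteq> {}" "\<phi> ` C \<subseteq> D" "D \<subseteq> {w \<in> Y. f w = y}" "connected D"
    have "connected (\<psi> ` D)"
      using D by (intro connected_continuous_image continuous_on_subset[OF homeomorphism_cont2[OF hom]]) auto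
    moreover have "\<psi> ` D \<subseteq> {x \<in> X. f (\<phi> x) = y}"
      using D(3) \<psi> by auto
    moreover have "C \<subseteq> \<psi> ` D"
    proof
      fix x assume "x \<in> C"
      then have "\<psi> (\<phi> x) = x" "\<phi> x \<in> D" using \<phi> D(2) sub(1) by auto
      then show "x \<in> \<psi> ` D" by (metis image_eqI)
    qed
    ultimately have "\<psi> ` D = C"
      using components_maximal[OF y] sub(3) by blast
    then have "\<phi> ` C = (\<lambda>w. \<phi> (\<psi> w)) ` D" by auto
    also have "\<dots> = D" using D(3) \<psi>(2) by (auto simp: subset_iff image_iff)
    finally show "D = \<phi> ` C" ..
  qed (use sub \<phi> in auto)
  then show ?thesis by (auto simp: contour_of_def)
qed

text \<open>A linear isometry from \<open>real^2\<close> followed by a translation carries the disc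
  result over; \<open>'n\<close> may be any two-element index type.\<close>

lemma disc_contour_in_plane:
  fixes a :: "real ^ 'n" and f :: "real ^ 'n \<Rightarrow> real"
  assumes dim: "CARD('n) = 2" and cont: "continuous_on (cball a 1) f"
  obtains C where "contour_of f (cball a 1) C" "sqrt 3 \<le> diameter (C \<inter> sphere a 1)"
proof -
  have "\<exists>(g :: real^2 \<Rightarrow> real^'n) h. linear g \<and> linear h \<and> (\<forall>x. norm (g x) = norm x) \<and>
      (\<forall>y. norm (h y) = norm y) \<and> (\<forall>x. h (g x) = x) \<and> (\<forall>y. g (h y) = y)"
  proof (rule isomorphisms_UNIV_UNIV[where 'M="real^2" and 'N="real^'n"])
    show "DIM(real^2) = DIM(real^'n)" using dim by simp
  qed blast
  then obtain g :: "real^2 \<Rightarrow> real^'n" and h where gh: "linear g" "linear h"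
      "\<And>x. norm (g x) = norm x" "\<And>y. norm (h y) = norm y" "\<And>x. h (g x) = x" "\<And>y. g (h y) = y"
    by blast
  define \<phi> \<psi> where "\<phi> z = a + g z" and "\<psi> x = h (x - a)" for x z
  have cg: "continuous_on S g" and ch: "continuous_on S' h" for S S'
    using gh linear_continuous_on linear_conv_bounded_linear by blast+
  have c: "continuous_on S \<phi>" "continuous_on S' \<psi>" for S S'
    unfolding \<phi>_def \<psi>_def
    by (intro continuous_intros cg continuous_on_compose2[OF ch[of UNIV]]; simp)+
  have inv: "\<psi> (\<phi> z) = z" "\<phi> (\<psi> x) = x" for x z by (simp_all add: \<phi>_def \<psi>_def gh)
  have dist_\<phi>: "dist (\<phi> z) (\<phi> w) = dist z w" for z w
    using gh by (simp add: \<phi>_def dist_norm flip: linear_diff)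
  have norm_\<phi>: "dist a (\<phi> z) = norm z" for z
    by (simp add: \<phi>_def dist_norm gh)
  have norm_\<psi>: "norm (\<psi> x) = dist a x" for x
    using norm_\<phi>[of "\<psi> x"] inv by simp
  have hom: "homeomorphism (cball 0 1) (cball a 1) \<phi> \<psi>"
    by (intro homeomorphismI c) (auto simp: inv norm_\<phi> norm_\<psi>)
  have "continuous_on (cball 0 1) (\<lambda>z. f (\<phi> z))"
    by (rule continuous_on_compose2[OF cont c(1)]) (auto simp: norm_\<phi>)
  then obtain C where C: "contour_of (\<lambda>z. f (\<phi> z)) (cball 0 1) C" "sqrt 3 \<le> diameter (C \<inter> sphere 0 1)"
    using disc_wide_contour by blast
  have im: "\<phi> ` C \<inter> sphere a 1 = \<phi> ` (C \<inter> sphere 0 1)"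
    by (auto simp: norm_\<phi>)
  have bd: "bounded (\<phi> ` C \<inter> sphere a 1)" by (simp add: bounded_Int)
  have "diameter (C \<inter> sphere 0 1) \<le> diameter (\<phi> ` C \<inter> sphere a 1)"
  proof (rule diameter_le)
    show "C \<inter> sphere 0 1 \<noteq> {} \<or> 0 \<le> diameter (\<phi> ` C \<inter> sphere a 1)"
      using diameter_ge_0[OF bd] by simp
    show "norm (z - w) \<le> diameter (\<phi> ` C \<inter> sphere a 1)"
      if "z \<in> C \<inter> sphere 0 1" "w \<in> C \<inter> sphere 0 1" for z w
      using diameter_bounded_bound[OF bd, of "\<phi> z" "\<phi> w"] that unfolding im dist_\<phi> dist_norm[symmetric]
      by blast
  qed
  then show ?thesis using contour_of_image[OF C(1) hom] C(2) that by force
qed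

text \<open>Apply the sphere result to \<open>f\<close> on the boundary. A connected set joining
  antipodal points within a level set of the sphere also lies in a level set of the ball, so one
  contour of the ball contains both points.\<close>

lemma ball_antipodal_contour:
  fixes a :: "'a::euclidean_space" and f :: "'a \<Rightarrow> real"
  assumes dim: "3 \<le> DIM('a)" and cont: "continuous_on (cball a 1) f"
  obtains C where "contour_of f (cball a 1) C" "diameter (C \<inter> sphere a 1) = 2"
proof -
  have "continuous_on (sphere 0 1) (\<lambda>z. f (a + z))"
    by (rule continuous_on_compose2[OF cont, of _ "(+) a"]) (auto intro: continuous_intros simp: dist_norm)
  then obtain x where x: "norm x = 1"
    and "connected_component {z \<in> sphere 0 1. f (a + z) = f (a + x)} x (- x)"
    using sphere_antipodal_contour[OF dim] by blast
  then obtain K where K: "connected K" "K \<subseteq> {z \<in> sphere 0 1. f (a + z) = f (a + x)}" "x \<in> K" "- x \<in> K"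
    unfolding connected_component_def by blast
  define L where "L = {z \<in> cball a 1. f z = f (a + x)}"
  define C where "C = connected_component_set L (a + x)"
  have xL: "a + x \<in> L" using x by (simp add: L_def dist_norm)
  then have "contour_of f (cball a 1) C"
    unfolding contour_of_def C_def L_def by (blast intro: componentsI)
  moreover have "(+) a ` K \<subseteq> C"
    unfolding C_def
  proof (rule connected_component_maximal)
    show "connected ((+) a ` K)"
      by (intro connected_continuous_image continuous_intros K(1))
  qed (use K in \<open>auto simp: L_def dist_norm\<close>)
  then have C: "a + x \<in> C \<inter> sphere a 1" "a + - x \<in> C \<inter> sphere a 1"
    using K(3,4) x by (auto simp: dist_norm image_subset_iff)
  have "diameter (C \<inter> sphere a 1) = 2"
  proof (rule antisym)
    have "diameter (C \<inter> sphere a 1) \<le> diameter (cball a 1)"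
      by (rule diameter_subset) auto
    then show "diameter (C \<inter> sphere a 1) \<le> 2" by simp
    have "dist (a + x) (a + - x) = norm (2 *\<^sub>R x)" by (simp add: dist_norm scaleR_2)
    then show "2 \<le> diameter (C \<inter> sphere a 1)"
      using diameter_bounded_bound[OF _ C] x by (simp add: bounded_Int)
  qed
  ultimately show ?thesis using that by blast
qed

theorem theorem6p2:
  fixes a :: "real ^ 'n" and f :: "real ^ 'n \<Rightarrow> real"
  assumes "CARD('n) \<ge> 2"
    and "continuous_on (cball a 1) f"
  shows "\<exists>C. contour_of f (cball a 1) C \<and>
    (CARD('n) = 2 \<longrightarrow> diameter (C \<inter> sphere a 1) \<ge> sqrt 3) \<and>
    (CARD('n) \<ge> 3 \<longrightarrow> diameter (C \<inter> sphere a 1) = 2)"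
proof (cases "CARD('n) = 2")
  case True
  then show ?thesis using disc_contour_in_plane[OF True assms(2)] by fastforce
next
  case False
  then have "3 \<le> DIM(real^'n)" using assms(1) by simp
  then show ?thesis using ball_antipodal_contour[OF _ assms(2)] False by metis
qed

end
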